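(* Let $C^{ijkl}$ be an elasticity tensor in three dimensions, $\rho>0$, and $n=(n_1,n_2,n_3)$ a unit covector. Let $A^{ijkl}:=C^{ijkl}-C^{(ijkl)}$ and let $\mathcal A^{il}:=\frac1\rho A^{ijkl}n_jn_k$ be the non-Cauchy Christoffel tensor. Then $\det(\mathcal A^{ij})=0$.
   Context: Indices run over $1,2,3$; summation over repeated indices. An elasticity tensor is a real fourth-rank tensor $C^{ijkl}$ on $\mathbb R^3$ with $C^{ijkl}=C^{jikl}$, $C^{ijkl}=C^{ijlk}$ (minor symmetries) and $C^{ijkl}=C^{klij}$ (major symmetry). $C^{(ijkl)}$ is $\frac1{4!}$ times the sum over all permutations of the indices. $\rho$ is the mass density. *)

theory Defs
  imports "HOL-Analysis.Analysis"
begin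

text \<open>
  Fourth-rank tensors on three-dimensional space are given by their components, with
  \<open>C $ i $ j $ k $ l\<close> standing for $C^{ijkl}$; covectors are given by their components in
  \<open>real ^ 3\<close>.
\<close>

type_synonym tensor4 = "real ^ 3 ^ 3 ^ 3 ^ 3"

definition elasticity_tensor :: "tensor4 \<Rightarrow> bool" where
  "elasticity_tensor C \<longleftrightarrow>
     (\<forall>i j k l. C $ i $ j $ k $ l = C $ j $ i $ k $ l) \<and>
     (\<forall>i j k l. C $ i $ j $ k $ l = C $ i $ j $ l $ k) \<and>
     (\<forall>i j k l. C $ i $ j $ k $ l = C $ k $ l $ i $ j)"

text \<open>The permutations act on the four index slots, numbered from 0.\<close>

definition total_sym :: "tensor4 \<Rightarrow> tensor4" where
  "total_sym C = (\<chi> i j k l. 1 / fact 4 *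
     (\<Sum>p | p permutes {0..<4::nat}.
        C $ ([i, j, k, l] ! p 0) $ ([i, j, k, l] ! p 1) $ ([i, j, k, l] ! p 2) $ ([i, j, k, l] ! p 3)))"

definition non_Cauchy_part :: "tensor4 \<Rightarrow> tensor4" where
  "non_Cauchy_part C = C - total_sym C"

definition non_Cauchy_Christoffel :: "tensor4 \<Rightarrow> real \<Rightarrow> real ^ 3 \<Rightarrow> real ^ 3 ^ 3" where
  "non_Cauchy_Christoffel C \<rho> n =
     (\<chi> i l. 1 / \<rho> * (\<Sum>j\<in>UNIV. \<Sum>k\<in>UNIV. non_Cauchy_part C $ i $ j $ k $ l * n $ j * n $ k))"

end

theory Submission imports Defs begin

text \<open>
  The covector \<open>n\<close> itself lies in the kernel of the non-Cauchy Christoffel tensor: contracting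
  $A^{ijkl}$ with $n_j n_k n_l$ only sees its part that is symmetric in \<open>j, k, l\<close>. By the
  symmetries of \<open>C\<close>, this part is the same for \<open>C\<close> and for its total symmetrization.
\<close>

text \<open>The symmetries of \<open>C\<close> generate a group of order 8, so the 24 summands form
  three classes of eight, told apart by the index paired with \<open>i\<close>.\<close>

lemma total_sym_elasticity_nth:
  assumes "elasticity_tensor C"
  shows "total_sym C $ i $ j $ k $ l
    = (C $ i $ j $ k $ l + C $ i $ k $ j $ l + C $ i $ l $ j $ k) / 3"
proof -
  have minor1: "\<And>i j k l. C $ i $ j $ k $ l = C $ j $ i $ k $ l"
    and minor2: "\<And>i j k l. C $ i $ j $ k $ l = C $ i $ j $ l $ k"
    and major: "\<And>i j k l. C $ i $ j $ k $ l = C $ k $ l $ i $ j"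
    using assms unfolding elasticity_tensor_def by blast+
  have slots: "{0..<4::nat} = insert 3 (insert 2 (insert 1 (insert 0 {})))"
    by auto
  \<comment> \<open>The three symmetries are permutative, so ordered rewriting with them brings the 24 summands
    to their three normal forms.\<close>
  show ?thesis
    unfolding total_sym_def slots
    by (simp add: sum_over_permutations_insert transpose_def fact_numeral eval_nat_numeral
        minor1 minor2 major)
qed

lemma non_Cauchy_Christoffel_mult_vec:
  assumes "elasticity_tensor C"
  shows "non_Cauchy_Christoffel C \<rho> n *v n = 0"
proof -
  have "(non_Cauchy_Christoffel C \<rho> n *v n) $ i = 0" for i
  proof -
    define T where "T j k l = C $ i $ j $ k $ l * n $ j * n $ k * n $ l" for j k l
    have swap_jk: "(\<Sum>l\<in>UNIV. \<Sum>j\<in>UNIV. \<Sum>k\<in>UNIV. T k j l) = (\<Sum>l\<in>UNIV. \<Sum>j\<in>UNIV. \<Sum>k\<in>UNIV. T j k l)"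
      by (rule sum.cong[OF refl], rule sum.swap)
    \<comment> \<open>Exchanging \<open>l\<close> and \<open>j\<close> on the right leaves a swap of
      the two inner sums.\<close>
    have rotate_jkl: "(\<Sum>l\<in>UNIV. \<Sum>j\<in>UNIV. \<Sum>k\<in>UNIV. T l j k) = (\<Sum>l\<in>UNIV. \<Sum>j\<in>UNIV. \<Sum>k\<in>UNIV. T j k l)"
      by (subst (2) sum.swap) (rule sum.cong[OF refl], rule sum.swap)
    \<comment> \<open>The factor 2 is 3 * (1 - 1/3); \<open>T k j l\<close> and
      \<open>T l j k\<close> are the other two pairings, as the product of the \<open>n\<close>
      components is symmetric.\<close>
    have "(non_Cauchy_Christoffel C \<rho> n *v n) $ i
      = (\<Sum>l\<in>UNIV. \<Sum>j\<in>UNIV. \<Sum>k\<in>UNIV. 1 / (3 * \<rho>) * (2 * T j k l - T k j l - T l j k))"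
      unfolding matrix_vector_mult_def non_Cauchy_Christoffel_def non_Cauchy_part_def T_def
      by (simp add: total_sym_elasticity_nth[OF assms] sum_distrib_left sum_distrib_right)
        (intro sum.cong refl, simp add: field_simps)
    also have "\<dots> = 1 / (3 * \<rho>) *
      (2 * (\<Sum>l\<in>UNIV. \<Sum>j\<in>UNIV. \<Sum>k\<in>UNIV. T j k l)
        - (\<Sum>l\<in>UNIV. \<Sum>j\<in>UNIV. \<Sum>k\<in>UNIV. T k j l) - (\<Sum>l\<in>UNIV. \<Sum>j\<in>UNIV. \<Sum>k\<in>UNIV. T l j k))"
      by (simp only: sum_distrib_left[symmetric] sum_subtractf)
    also have "\<dots> = 0"
      unfolding swap_jk rotate_jkl by simp
    finally show ?thesis .
  qed
  then show ?thesis
    by (simp add: vec_eq_iff)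
qed

theorem proposition14:
  fixes C :: tensor4 and \<rho> :: real and n :: "real ^ 3"
  assumes "elasticity_tensor C" and "\<rho> > 0" and "norm n = 1"
  shows "det (non_Cauchy_Christoffel C \<rho> n) = 0"
proof (rule ccontr)
  assume "det (non_Cauchy_Christoffel C \<rho> n) \<noteq> 0"
  then obtain B where "B ** non_Cauchy_Christoffel C \<rho> n = mat 1"
    using invertible_det_nz invertible_left_inverse by blast
  \<comment> \<open>A left inverse forces a trivial kernel.\<close>
  then have "n = 0"
    using non_Cauchy_Christoffel_mult_vec[OF assms(1)] matrix_left_invertible_ker by blast
  with \<open>norm n = 1\<close> show False
    by simp
qed

end
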